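(* Let $(a_i)$ be a representing sequence with $a_1=k$, and let $w$ be its representation word; assume $w$ is strongly Fergusonian. Let $T=\{a_i-1\mid i\geq2\}\cup\{1,\dots,k-1\}$, let $N$ be the set of non-volatile zends with respect to $(a_i)$, and let $L=\mathbb{N}\setminus N$ (with $\mathbb N=\{0,1,2,\dots\}$). Let $I$ be a set of positive integers with $T\subseteq I$ and $(N+I)\cap N=\emptyset$. Then: (1) for every set $S$ with $T\subseteq S\subseteq I$, $w$ is the Nim sequence of $S$; (2) for every such $S$ and every $i$, writing $S_i=\{s\in S\mid s<a_i\}$: if $a+a_i-S_i\subseteq L$ for all $a\in N$ with $a<a_i$, then $\big(w[0..a_i)\big)^\omega$ is the Nim sequence of $S_i$.
   Context: A representing sequence is a strictly increasing sequence $(a_i)_{i\ge0}$ of positive integers with $a_0=1$. For $n\ge1$ with $a_j\le n<a_{j+1}$, the $(a_i)$-representation of $n$ is the digit string $d_j\cdots d_0$ with $n=\sum d_ia_i$ and $\sum d_i$ minimal (greedy); the representation of $0$ is the single digit $0$. $n$ is a zend if its representation ends in $0$. For a positive integer $m$, $n\ge0$ is $m$-volatile if the representation of $n+1$ ends in at least $m$ zeros; volatile means $1$-volatile; non-volatile means the representation of $n+1$ does not end in $0$. The representation word of $(a_i)$ is the word $w$ over $\{0,\dots,a_1\}$ with $w[n]=a_1$ if $n$ is $2$-volatile, and otherwise $w[n]$ is the last digit of the representation of $n$. A word over $\{0,1,\dots,k\}$ ($k\ge2$) is Fergusonian if for every $0\le i<k-1$ every occurrence of $i$ is immediately followed by $i+1$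 and every occurrence of $i+1$ is immediately preceded by $i$; it is strongly Fergusonian if moreover it has no two consecutive $k$'s. For sets $A,B$ and integer $n$: $A+B=\{a+b\}$, $n-A=\{n-a\}$, $A+n=\{a+n\}$, etc. Words are indexed from $0$; $w[a..b)$ is the factor from position $a$ to $b-1$; $u^\omega$ is the infinite repetition of $u$. For a set $S$ of positive integers, $\mathrm{SG}_S(n)=\mathrm{mex}\{\mathrm{SG}_S(n-s)\mid s\in S,s\le n\}$ and the Nim sequence of $S$ is $(\mathrm{SG}_S(n))_{n\ge0}$. *)

theory Defs
  imports Main "HOL-Library.Set_Algebras"
begin

subsection \<open>Representations of natural numbers\<close>

definition representing_sequence :: "(nat \<Rightarrow> nat) \<Rightarrow> bool" where
  "representing_sequence a \<longleftrightarrow> strict_mono a \<and> (\<forall>i. 0 < a i) \<and> a 0 = 1"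

text \<open>
  Digit strings are lists with the most significant digit first.  The string
  \<open>d\<^sub>j \<dots> d\<^sub>0\<close> is the greedy one: each digit is the largest possible, given the digits
  to its left.  Minimality of the digit sum alone does not determine a string
  (for \<open>1, 2, 3, 5, \<dots>\<close> one has \<open>4 = 3 + 1 = 2 + 2\<close>).
\<close>

primrec greedy_digits :: "(nat \<Rightarrow> nat) \<Rightarrow> nat \<Rightarrow> nat \<Rightarrow> nat list" where
  "greedy_digits a 0 n = [n div a 0]"
| "greedy_digits a (Suc j) n = (n div a (Suc j)) # greedy_digits a j (n mod a (Suc j))"

text \<open>For \<open>n \<ge> 1\<close> the leading position is the \<open>j\<close> with \<open>a j \<le> n < a (j + 1)\<close>.\<close>

definition representation :: "(nat \<Rightarrow> nat) \<Rightarrow> nat \<Rightarrow> nat list" where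
  "representation a n =
     (if n = 0 then [0] else greedy_digits a (THE j. a j \<le> n \<and> n < a (Suc j)) n)"

definition ends_in_zeros :: "nat \<Rightarrow> nat list \<Rightarrow> bool" where
  "ends_in_zeros m ds \<longleftrightarrow> (\<exists>us. ds = us @ replicate m 0)"

definition zend :: "(nat \<Rightarrow> nat) \<Rightarrow> nat \<Rightarrow> bool" where
  "zend a n \<longleftrightarrow> ends_in_zeros 1 (representation a n)"

definition m_volatile :: "(nat \<Rightarrow> nat) \<Rightarrow> nat \<Rightarrow> nat \<Rightarrow> bool" where
  "m_volatile a m n \<longleftrightarrow> ends_in_zeros m (representation a (n + 1))"

definition volatile :: "(nat \<Rightarrow> nat) \<Rightarrow> nat \<Rightarrow> bool" where
  "volatile a n \<longleftrightarrow> m_volatile a 1 n"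


subsection \<open>Infinite words over the natural numbers\<close>

type_synonym word = "nat \<Rightarrow> nat"

definition representation_word :: "(nat \<Rightarrow> nat) \<Rightarrow> word" where
  "representation_word a n =
     (if m_volatile a 2 n then a 1 else last (representation a n))"

definition fergusonian :: "nat \<Rightarrow> word \<Rightarrow> bool" where
  "fergusonian k w \<longleftrightarrow>
     k \<ge> 2 \<and> range w \<subseteq> {0..k} \<and>
     (\<forall>i < k - 1.
        (\<forall>n. w n = i \<longrightarrow> w (n + 1) = i + 1) \<and>
        (\<forall>n. w n = i + 1 \<longrightarrow> n \<ge> 1 \<and> w (n - 1) = i))"

definition strongly_fergusonian :: "nat \<Rightarrow> word \<Rightarrow> bool" where
  "strongly_fergusonian k w \<longleftrightarrow>
     fergusonian k w \<and> \<not> (\<exists>n. w n = k \<and> w (n + 1) = k)"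

text \<open>\<open>factor w b c\<close> is \<open>w[b..c)\<close> and \<open>omega_power u\<close> is the infinite repetition of \<open>u\<close>.\<close>

definition factor :: "word \<Rightarrow> nat \<Rightarrow> nat \<Rightarrow> nat list" where
  "factor w b c = map w [b..<c]"

definition omega_power :: "nat list \<Rightarrow> word" where
  "omega_power u n = u ! (n mod length u)"


subsection \<open>Subtraction games\<close>

definition mex :: "nat set \<Rightarrow> nat" where
  "mex A = (LEAST m. m \<notin> A)"

text \<open>
  The guard \<open>0 < s\<close> only serves to make the recursion terminate for arbitrary \<open>S\<close>;
  it is vacuous for sets of positive integers.
\<close>

function SG :: "nat set \<Rightarrow> nat \<Rightarrow> nat" where
  "SG S n = mex ((\<lambda>s. SG S (n - s)) ` {s \<in> S. 0 < s \<and> s \<le> n})"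
  by auto
termination
  by (relation "measure snd") auto

declare SG.simps [simp del]

definition is_nim_sequence :: "word \<Rightarrow> nat set \<Rightarrow> bool" where
  "is_nim_sequence u S \<longleftrightarrow> (\<forall>n. u n = SG S n)"


subsection \<open>Basic facts\<close>

lemma representing_sequence_bracket:
  assumes "representing_sequence a" "1 \<le> n"
  shows "\<exists>!j. a j \<le> n \<and> n < a (Suc j)"
proof -
  have sm: "strict_mono a" and a0: "a 0 = 1"
    using assms(1) by (auto simp: representing_sequence_def)
  have ge: "i \<le> a i" for i
    using strict_mono_imp_increasing[OF sm] by simp
  define j where "j = (LEAST j. n < a (Suc j))"
  have ex: "n < a (Suc n)"
    using ge[of "Suc n"] by simp
  have up: "n < a (Suc j)"
    unfolding j_def by (rule LeastI[of "\<lambda>j. n < a (Suc j)", OF ex])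
  have low: "a j \<le> n"
  proof (cases j)
    case 0
    then show ?thesis using a0 assms(2) by simp
  next
    case (Suc i)
    then have "\<not> n < a (Suc i)"
      using not_less_Least[of i "\<lambda>j. n < a (Suc j)"] unfolding j_def by simp
    then show ?thesis using Suc by simp
  qed
  show ?thesis
  proof (rule ex1I[of _ j])
    show "a j \<le> n \<and> n < a (Suc j)" using low up by simp
    fix l assume l: "a l \<le> n \<and> n < a (Suc l)"
    have "a l < a (Suc j)" "a j < a (Suc l)" using l low up by auto
    then show "l = j" by (simp add: strict_mono_less[OF sm])
  qed
qed

lemma length_greedy_digits: "length (greedy_digits a j n) = Suc j"
  by (induction j arbitrary: n) simp_all

lemma greedy_digits_value:
  assumes "a 0 = 1"
  shows "(\<Sum>i\<le>j. rev (greedy_digits a j n) ! i * a i) = n"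
proof (induction j arbitrary: n)
  case 0
  then show ?case using assms by simp
next
  case (Suc j)
  have "(\<Sum>i\<le>j. rev (greedy_digits a (Suc j) n) ! i * a i)
      = (\<Sum>i\<le>j. rev (greedy_digits a j (n mod a (Suc j))) ! i * a i)"
    by (rule sum.cong) (simp_all add: nth_append length_greedy_digits)
  also have "\<dots> = n mod a (Suc j)" by (rule Suc.IH)
  finally show ?case
    by (simp add: nth_append length_greedy_digits)
qed

end

theory Submission
  imports Defs
begin

text \<open>
  The set of non-volatile zends is exactly \<open>w\<^sup>-\<^sup>1(0)\<close>, and \<open>w\<close> is a concatenation of blocks
  \<open>0 1 \<dots> (k-1)\<close> and \<open>0 1 \<dots> k\<close>.  If two positions at distance \<open>s \<in> I\<close> carried the
  same letter, then shifting both to the starts of their blocks (or, for the letter \<open>k\<close>, to the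
  starts of the next blocks) would give two zeros of \<open>w\<close> at distance \<open>s\<close>, which is excluded.
  Conversely, every letter smaller than \<open>w[n]\<close> occurs earlier in the block of \<open>n\<close>, at a distance in
  \<open>{1..k-1}\<close>, except for the letter \<open>0\<close> when \<open>w[n] = k\<close>.  In that case let \<open>a\<^sub>i\<close> be the least
  term occurring in the representation of \<open>n + 1\<close>; then \<open>n - (a\<^sub>i - 1)\<close> is a non-volatile zend.
  The periodic case is the same argument modulo \<open>a\<^sub>i\<close>; its hypothesis excludes zeros at a distance
  in \<open>S\<^sub>i\<close> across the border of two periods.
\<close>

section \<open>Greedy digit strings\<close>

lemma greedy_digits_nonempty [simp]: "greedy_digits a j n \<noteq> []"
  by (cases j) simp_all

lemma last_greedy_digits_Suc [simp]:
  "last (greedy_digits a (Suc j) n) = last (greedy_digits a j (n mod a (Suc j)))"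
  by simp

lemma last_greedy_digits_0 [simp]: "last (greedy_digits a j 0) = 0"
  by (induction j) simp_all

lemma representing_sequence_gt_1:
  assumes "representing_sequence a" "0 < i"
  shows "1 < a i"
  using assms strict_monoD[of a 0 i] by (simp add: representing_sequence_def)

lemma last_greedy_digits_1:
  assumes "representing_sequence a"
  shows "last (greedy_digits a j 1) = 1"
proof (induction j)
  case 0
  then show ?case using assms by (simp add: representing_sequence_def)
next
  case (Suc j)
  have "1 mod a (Suc j) = 1"
    using representing_sequence_gt_1[OF assms, of "Suc j"] by simp
  then show ?case using Suc by (simp only: last_greedy_digits_Suc)
qed

lemma last_greedy_digits_leading_zeros:
  assumes "representing_sequence a" "n < a (Suc j)" "j \<le> l"
  shows "last (greedy_digits a l n) = last (greedy_digits a j n)"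
  using assms(3)
proof (induction l rule: dec_induct)
  case base
  show ?case by simp
next
  case (step l)
  have "a (Suc j) \<le> a (Suc l)"
    using step.hyps assms(1) by (simp add: representing_sequence_def strict_mono_less_eq)
  then have "n mod a (Suc l) = n" using assms(2) by simp
  then show ?case using step.IH by (simp only: last_greedy_digits_Suc)
qed

lemma representation_greedy_digits:
  assumes "representing_sequence a" "1 \<le> n"
  obtains j where "a j \<le> n" "n < a (Suc j)" "representation a n = greedy_digits a j n"
proof -
  let ?j = "THE j. a j \<le> n \<and> n < a (Suc j)"
  have "a ?j \<le> n \<and> n < a (Suc ?j)"
    by (rule theI'[OF representing_sequence_bracket[OF assms]])
  moreover have "representation a n = greedy_digits a ?j n"
    using assms(2) by (simp add: representation_def)
  ultimately show ?thesis using that by blast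
qed

text \<open>Frees the last digit from the choice of leading position: positions above it only
  prepend zeros. Last digits of different numbers can then be compared through strings of one
  length.\<close>

lemma last_representation:
  assumes "representing_sequence a" "n < a (Suc j)"
  shows "last (representation a n) = last (greedy_digits a j n)"
proof (cases "n = 0")
  case True
  then show ?thesis by (simp add: representation_def)
next
  case False
  then obtain l where l: "a l \<le> n" "n < a (Suc l)" "representation a n = greedy_digits a l n"
    using representation_greedy_digits[OF assms(1), of n] by auto
  have "a l < a (Suc j)" using l(1) assms(2) by simp
  then have "l \<le> j"
    using assms(1) by (simp add: representing_sequence_def strict_mono_less)
  then show ?thesis
    using last_greedy_digits_leading_zeros[OF assms(1) l(2), of j] l(3) by simp
qed

lemma representation_nonempty [simp]: "representation a n \<noteq> []"
  by (simp add: representation_def)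

lemma ends_in_zeros_1_iff: "ds \<noteq> [] \<Longrightarrow> ends_in_zeros 1 ds \<longleftrightarrow> last ds = 0"
  by (cases ds rule: rev_cases) (auto simp: ends_in_zeros_def)

lemma ends_in_zeros_2_iff: "ends_in_zeros 2 ds \<longleftrightarrow> (\<exists>us. ds = us @ [0, 0])"
  by (simp add: ends_in_zeros_def numeral_2_eq_2)

lemma zend_iff: "zend a n \<longleftrightarrow> last (representation a n) = 0"
  unfolding zend_def by (rule ends_in_zeros_1_iff) simp

lemma volatile_iff: "volatile a n \<longleftrightarrow> last (representation a (n + 1)) = 0"
  unfolding volatile_def m_volatile_def by (rule ends_in_zeros_1_iff) simp

lemma volatile_if_2_volatile: "m_volatile a 2 n \<Longrightarrow> volatile a n"
  by (auto simp: volatile_iff m_volatile_def ends_in_zeros_2_iff)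

text \<open>Lowering the last nonzero digit by one leaves a greedy string, and so does then raising the
  last digit to \<open>1\<close>.\<close>

lemma greedy_digits_remove_least_term:
  assumes "representing_sequence a" "ends_in_zeros 2 (greedy_digits a j m)" "1 \<le> m"
  shows "\<exists>i\<ge>2. i \<le> j \<and> a i \<le> m \<and> last (greedy_digits a j (m - a i)) = 0
           \<and> last (greedy_digits a j (m - a i + 1)) = 1"
  using assms(2,3)
proof (induction j arbitrary: m)
  case 0
  then show ?case by (auto simp: ends_in_zeros_2_iff)
next
  case (Suc j)
  let ?A = "a (Suc j)"
  let ?r = "m mod ?A"
  have A: "1 < ?A" using representing_sequence_gt_1[OF assms(1)] by simp
  obtain us where us: "m div ?A # greedy_digits a j ?r = us @ [0, 0]"
    using Suc.prems(1) by (auto simp: ends_in_zeros_2_iff)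
  have m: "m = m div ?A * ?A + ?r" by simp
  \<comment> \<open>A string of just two digits, both zero, would give \<open>m = 0\<close>. So
    \<open>Suc j\<close> is at least 2, and both trailing zeros lie in the string of
    \<open>?r\<close>.\<close>
  have j: "0 < j"
  proof (rule ccontr)
    assume "\<not> 0 < j"
    then have "m div ?A = 0 \<and> ?r = 0"
      using us assms(1) by (cases us) (auto simp: representing_sequence_def)
    then show False using m Suc.prems(2) by simp
  qed
  show ?case
  \<comment> \<open>If \<open>?r = 0\<close>, the least term is \<open>?A\<close> itself; otherwise
    it is found inside \<open>?r\<close>.\<close>
  proof (cases "?r = 0")
    case True
    then obtain q where q: "m = ?A * q" by auto
    then have "0 < q" using Suc.prems(2) by (cases q) auto
    then obtain p where "q = Suc p" by (cases q) auto
    then have p: "m - ?A = ?A * p" "?A \<le> m" using q by auto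
    have "(m - ?A) mod ?A = 0" "(m - ?A + 1) mod ?A = 1"
      unfolding p(1) using A by (simp, metis add.commute mod_less mod_mult_self2)
    then have "last (greedy_digits a (Suc j) (m - ?A)) = 0"
      "last (greedy_digits a (Suc j) (m - ?A + 1)) = 1"
      using last_greedy_digits_1[OF assms(1), of j]
      by (simp_all only: last_greedy_digits_Suc last_greedy_digits_0)
    then show ?thesis using j p(2) by (intro exI[of _ "Suc j"]) auto
  next
    case False
    have "length us = j" using arg_cong[OF us, of length] by (simp add: length_greedy_digits)
    then have "ends_in_zeros 2 (greedy_digits a j ?r)"
      using us j by (cases us) (auto simp: ends_in_zeros_2_iff)
    then obtain i where i: "2 \<le> i" "i \<le> j" "a i \<le> ?r"
      "last (greedy_digits a j (?r - a i)) = 0" "last (greedy_digits a j (?r - a i + 1)) = 1"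
      using Suc.IH[of ?r] False by auto
    \<comment> \<open>\<open>0 < a i\<close> keeps \<open>?r - a i + 1\<close> below
      \<open>?A\<close>, so that adding 1 leaves the quotient by \<open>?A\<close>
      unchanged.\<close>
    have r: "?r < ?A" "0 < a i" using A representing_sequence_gt_1[OF assms(1), of i] i(1) by simp_all
    have "m - a i = (?r - a i) + m div ?A * ?A" "m - a i + 1 = (?r - a i + 1) + m div ?A * ?A"
      using m i(3) by linarith+
    then have "(m - a i) mod ?A = ?r - a i" "(m - a i + 1) mod ?A = ?r - a i + 1"
      using r i(3) by (simp_all only: mod_mult_self1) simp_all
    then have "last (greedy_digits a (Suc j) (m - a i)) = 0"
      "last (greedy_digits a (Suc j) (m - a i + 1)) = 1"
      using i(4,5) by (simp_all only: last_greedy_digits_Suc)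
    moreover have "a i \<le> m" using i(3) m by linarith
    ultimately show ?thesis using i(1,2) by (intro exI[of _ i]) auto
  qed
qed

text \<open>Supplies the move from a letter \<open>a 1\<close> to a zero of the representation word:
  taking \<open>a i - 1\<close> from \<open>n\<close> is taking the term \<open>a i\<close> from
  \<open>n + 1\<close>.\<close>

lemma m_volatile_2_minus_term:
  assumes "representing_sequence a" "m_volatile a 2 n"
  shows "\<exists>i\<ge>2. a i - 1 \<le> n \<and> zend a (n - (a i - 1)) \<and> \<not> volatile a (n - (a i - 1))"
proof -
  obtain j where j: "n + 1 < a (Suc j)" "representation a (n + 1) = greedy_digits a j (n + 1)"
    using representation_greedy_digits[OF assms(1), of "n + 1"] by auto
  then obtain i where i: "2 \<le> i" "a i \<le> n + 1"
    "last (greedy_digits a j (n + 1 - a i)) = 0" "last (greedy_digits a j (n + 1 - a i + 1)) = 1"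
    using greedy_digits_remove_least_term[OF assms(1), of j "n + 1"] assms(2)
    by (auto simp: m_volatile_def)
  have pos: "1 < a i" using representing_sequence_gt_1[OF assms(1), of i] i(1) by simp
  then have eq: "n - (a i - 1) = n + 1 - a i" using i(2) by simp
  have "last (representation a (n + 1 - a i)) = 0"
    using last_representation[OF assms(1), of "n + 1 - a i" j] i(3) j(1) by simp
  moreover have "last (representation a (n + 1 - a i + 1)) = 1"
    using last_representation[OF assms(1), of "n + 1 - a i + 1" j] i(2,4) j(1) pos by simp
  ultimately have "zend a (n - (a i - 1)) \<and> \<not> volatile a (n - (a i - 1))"
    unfolding eq zend_iff volatile_iff by simp
  then show ?thesis using i(1,2) by (intro exI[of _ i]) auto
qed

section \<open>Fergusonian words\<close>

lemma fergusonian_le: "fergusonian k w \<Longrightarrow> w n \<le> k"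
  unfolding fergusonian_def by (metis atLeastAtMost_iff rangeI subsetD)

lemma fergusonian_Suc: "fergusonian k w \<Longrightarrow> w n < k - 1 \<Longrightarrow> w (n + 1) = w n + 1"
  unfolding fergusonian_def by blast

lemma fergusonian_pred:
  assumes "fergusonian k w" "w n \<noteq> 0" "w n \<noteq> k"
  shows "1 \<le> n \<and> w (n - 1) = w n - 1"
proof -
  have "w n - 1 < k - 1" "w n = (w n - 1) + 1"
    using fergusonian_le[OF assms(1), of n] assms(2,3) by linarith+
  then show ?thesis using assms(1) unfolding fergusonian_def by blast
qed

text \<open>A letter \<open>v\<close> with \<open>0 < v < k\<close> must be preceded by
  \<open>v - 1\<close>, which is not \<open>k\<close>, and strongness forbids a second
  \<open>k\<close>; only 0 is left.\<close>

lemma strongly_fergusonian_Suc_max: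
  assumes "strongly_fergusonian k w" "w n = k"
  shows "w (n + 1) = 0"
proof (rule ccontr)
  have ferg: "fergusonian k w" and "w (n + 1) \<noteq> k"
    using assms unfolding strongly_fergusonian_def by blast+
  moreover assume "w (n + 1) \<noteq> 0"
  ultimately have "k = w (n + 1) - 1"
    using fergusonian_pred[OF ferg, of "n + 1"] assms(2) by simp
  then show False
    using fergusonian_le[OF ferg, of "n + 1"] \<open>w (n + 1) \<noteq> 0\<close> \<open>w (n + 1) \<noteq> k\<close> by linarith
qed

text \<open>This is the block structure: walking back from a letter, the letters descend by one
  until the block starts with 0.\<close>

lemma strongly_fergusonian_minus:
  assumes "strongly_fergusonian k w" "w 0 = 0" "v \<le> w n"
  shows "v \<le> n \<and> w (n - v) = w n - v"
  using assms(3)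
proof (induction v)
  case (Suc v)
  have ferg: "fergusonian k w" using assms(1) by (simp add: strongly_fergusonian_def)
  let ?m = "n - v"
  have IH: "v \<le> n" "w ?m = w n - v" using Suc by auto
  have pos: "0 < w ?m" using IH Suc.prems by simp
  then have "?m \<noteq> 0" using assms(2) by (metis less_irrefl)
  then have m: "?m - 1 + 1 = ?m" by simp
  have "w (?m - 1) = w ?m - 1"
  \<comment> \<open>The predecessor condition does not cover the letter \<open>k\<close>. There the
    other candidates are excluded: \<open>k\<close> is followed by 0, and a letter below
    \<open>k - 1\<close> by its successor, which is below \<open>k\<close>.\<close>
  proof (cases "w ?m = k")
    case True
    have "w (?m - 1) \<noteq> k"
      using strongly_fergusonian_Suc_max[OF assms(1), of "?m - 1"] pos unfolding m by linarith
    moreover have "w (?m - 1) \<le> k" using fergusonian_le[OF ferg] .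
    moreover have "\<not> w (?m - 1) < k - 1"
      using fergusonian_Suc[OF ferg, of "?m - 1"] True unfolding m by linarith
    ultimately show ?thesis using True by linarith
  next
    case False
    then show ?thesis using fergusonian_pred[OF ferg, of ?m] pos by simp
  qed
  then show ?case using IH m Suc.prems by (simp add: diff_diff_left)
qed simp

section \<open>Representation words\<close>

lemma representation_word_0:
  assumes "representing_sequence a"
  shows "representation_word a 0 = 0"
proof -
  have "last (representation a 1) = 1"
    using last_representation[OF assms, of 1 0] representing_sequence_gt_1[OF assms, of 1]
      last_greedy_digits_1[OF assms, of 0] by simp
  then have "\<not> volatile a 0" by (simp add: volatile_iff)
  then have "\<not> m_volatile a 2 0" using volatile_if_2_volatile by blast
  then show ?thesis by (simp add: representation_word_def representation_def)
qed

text \<open>By itself the letter 0 does not exclude that \<open>n\<close> is volatile. The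
  Fergusonian property does: the next letter is 1, hence not \<open>a 1\<close>, and so it is the
  last digit of \<open>n + 1\<close>.\<close>

lemma representation_word_eq_0_iff:
  assumes "representing_sequence a" "fergusonian (a 1) (representation_word a)"
  shows "representation_word a n = 0 \<longleftrightarrow> zend a n \<and> \<not> volatile a n"
proof
  have k: "2 \<le> a 1" using assms(2) by (simp add: fergusonian_def)
  assume *: "representation_word a n = 0"
  then have "representation_word a (n + 1) = 1"
    using fergusonian_Suc[OF assms(2), of n] k by simp
  then show "zend a n \<and> \<not> volatile a n"
    using * k by (auto simp: representation_word_def zend_iff volatile_iff split: if_splits)
next
  assume "zend a n \<and> \<not> volatile a n"
  then show "representation_word a n = 0"
    using volatile_if_2_volatile by (auto simp: representation_word_def zend_iff)
qed

text \<open>Once position 1 is present, the last digit is a remainder modulo \<open>a 1\<close>, so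
  the letter \<open>a 1\<close> can only mark 2-volatility.\<close>

lemma representation_word_eq_max:
  assumes "representing_sequence a" "representation_word a n = a 1"
  shows "m_volatile a 2 n"
proof (rule ccontr)
  assume "\<not> m_volatile a 2 n"
  then have last: "last (representation a n) = a 1"
    using assms(2) by (simp add: representation_word_def)
  have "last (greedy_digits a j n) < a 1" if "0 < j" for j n
    using that
  proof (induction j arbitrary: n)
    case (Suc j)
    have "1 < a 1" using representing_sequence_gt_1[OF assms(1)] by simp
    then show ?case using Suc assms(1) by (cases "j = 0") (auto simp: representing_sequence_def)
  qed simp
  moreover obtain j where "n < a (Suc j)"
    using assms(1) strict_mono_imp_increasing[of a "Suc n"]
    by (auto simp: representing_sequence_def intro: that[of n])
  \<comment> \<open>One further position guarantees that position 1 is present, as the digit bound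
    requires.\<close>
  then have "n < a (Suc (Suc j))"
    using assms(1) by (meson Suc_lessD lessI order.strict_trans representing_sequence_def strict_monoD)
  ultimately show False using last_representation[OF assms(1)] last by (metis less_irrefl zero_less_Suc)
qed

section \<open>Nim sequences\<close>

lemma mex_eqI:
  assumes "m \<notin> A" "\<And>v. v < m \<Longrightarrow> v \<in> A"
  shows "mex A = m"
  unfolding mex_def by (rule Least_equality) (use assms not_less in blast)+

text \<open>Stated for an arbitrary word \<open>u\<close> so that it serves both \<open>w\<close>
  and its periodic versions. \<open>zero\<close> is a separate assumption because
  \<open>small\<close> stops at \<open>k - 1\<close>, short of the distance from a letter
  \<open>k\<close> to the start of its block.\<close>

lemma is_nim_sequenceI:
  assumes block: "\<And>n v. v \<le> u n \<Longrightarrow> v \<le> n \<and> u (n - v) = u n - v"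
    and le: "\<And>n. u n \<le> k"
    and after: "\<And>n. u n = k \<Longrightarrow> u (n + 1) = 0"
    and zero: "\<And>n. u n = k \<Longrightarrow> \<exists>s\<in>S. 0 < s \<and> s \<le> n \<and> u (n - s) = 0"
    and small: "{1..k - 1} \<subseteq> S"
    and avoid: "\<And>n s. s \<in> S \<Longrightarrow> 0 < s \<Longrightarrow> u n = 0 \<Longrightarrow> u (n + s) \<noteq> 0"
  shows "is_nim_sequence u S"
  unfolding is_nim_sequence_def
proof
  fix n
  show "u n = SG S n"
  proof (induction n rule: less_induct)
    case (less n)
    let ?M = "{s \<in> S. 0 < s \<and> s \<le> n}"
    have img: "(\<lambda>s. SG S (n - s)) ` ?M = (\<lambda>s. u (n - s)) ` ?M"
      by (rule image_cong) (use less.IH in auto)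
    have "mex ((\<lambda>s. u (n - s)) ` ?M) = u n"
    proof (rule mex_eqI)
      show "u n \<notin> (\<lambda>s. u (n - s)) ` ?M"
      proof
        assume "u n \<in> (\<lambda>s. u (n - s)) ` ?M"
        then obtain s where s: "s \<in> S" "0 < s" "s \<le> n" "u (n - s) = u n" by auto
        show False
        proof (cases "u n = k")
          case True
          then have "u (n - s + 1) = 0" "u (n - s + 1 + s) = 0"
            using after[of n] after[of "n - s"] s by simp_all
          then show False using avoid s by blast
        next
          case False
          have "u n \<le> n - s" "u (n - s - u n) = 0" "u (n - u n) = 0"
            using block[of "u n" n] block[of "u n" "n - s"] s(4) by simp_all
          moreover have "n - u n = n - s - u n + s" using s(3) \<open>u n \<le> n - s\<close> by simp
          ultimately show False using avoid s by metis
        qed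
      qed
    next
      fix v assume v: "v < u n"
      show "v \<in> (\<lambda>s. u (n - s)) ` ?M"
      proof (cases "v = 0 \<and> u n = k")
        case True
        then show ?thesis using zero[of n] by force
      next
        case False
        \<comment> \<open>The difference reaches \<open>k\<close> only for \<open>v = 0\<close> and
          \<open>u n = k\<close>, the case just settled.\<close>
        then have "u n - v \<in> {1..k - 1}" using v le[of n] by auto
        then have "u n - v \<in> ?M" using small block[of "u n - v" n] by auto
        moreover have "v = u (n - (u n - v))" using block[of "u n - v" n] v by simp
        ultimately show ?thesis by blast
      qed
    qed
    then show ?case by (subst SG.simps) (simp add: img)
  qed
qed

lemma SG_empty: "SG {} n = 0"
  by (subst SG.simps) (simp add: mex_def)

lemma omega_power_factor_0: "0 < l \<Longrightarrow> omega_power (factor w 0 l) n = w (n mod l)"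
  by (simp add: omega_power_def factor_def)

theorem theorem4p11:
  fixes a :: "nat \<Rightarrow> nat" and k :: nat and w :: word and T N L I :: "nat set"
  assumes "representing_sequence a"
    and "a 1 = k"
    and "w = representation_word a"
    and "strongly_fergusonian k w"
    and "T = {a i - 1 | i. i \<ge> 2} \<union> {1..k - 1}"
    and "N = {n. zend a n \<and> \<not> volatile a n}"
    and "L = UNIV - N"
    and "\<forall>s \<in> I. 0 < s"
    and "T \<subseteq> I"
    and "(N + I) \<inter> N = {}"
  shows "(\<forall>S. T \<subseteq> S \<and> S \<subseteq> I \<longrightarrow> is_nim_sequence w S) \<and>
    (\<forall>S i. T \<subseteq> S \<and> S \<subseteq> I \<longrightarrow>
       (\<forall>b \<in> N. b < a i \<longrightarrow> {b + a i - s | s. s \<in> {s \<in> S. s < a i}} \<subseteq> L) \<longrightarrow>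
       is_nim_sequence (omega_power (factor w 0 (a i))) {s \<in> S. s < a i})"
proof -
  have w0: "w 0 = 0" using representation_word_0[OF assms(1)] assms(3) by simp
  have N_iff: "n \<in> N \<longleftrightarrow> w n = 0" for n
    using representation_word_eq_0_iff[OF assms(1)] assms(2-4,6)
    by (simp add: strongly_fergusonian_def)
  have block: "v \<le> n \<and> w (n - v) = w n - v" if "v \<le> w n" for n v
    using strongly_fergusonian_minus[OF assms(4) w0 that] .
  have le: "w n \<le> k" for n
    using assms(4) fergusonian_le by (simp add: strongly_fergusonian_def)
  have after: "w (n + 1) = 0" if "w n = k" for n
    using strongly_fergusonian_Suc_max[OF assms(4) that] .
  have zero: "\<exists>s\<in>T. 0 < s \<and> s \<le> n \<and> w (n - s) = 0" if "w n = k" for n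
  proof -
    have "m_volatile a 2 n"
      using representation_word_eq_max[OF assms(1), of n] that assms(2,3) by simp
    then obtain i where i: "2 \<le> i" "a i - 1 \<le> n" "n - (a i - 1) \<in> N"
      using m_volatile_2_minus_term[OF assms(1)] assms(6) by blast
    moreover have "0 < a i - 1" using representing_sequence_gt_1[OF assms(1), of i] i(1) by simp
    moreover have "a i - 1 \<in> T" using assms(5) i(1) by auto
    ultimately show ?thesis using N_iff by blast
  qed
  have avoid: "w (n + s) \<noteq> 0" if "s \<in> I" "w n = 0" for n s
  proof -
    have "n + s \<in> N + I" using that N_iff by (intro set_plus_intro) auto
    then have "n + s \<notin> N" using assms(10) by blast
    then show ?thesis using N_iff by simp
  qed
  have nim: "is_nim_sequence w S" if S: "T \<subseteq> S" "S \<subseteq> I" for S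
  proof (rule is_nim_sequenceI[where k = k])
    show "\<exists>s\<in>S. 0 < s \<and> s \<le> n \<and> w (n - s) = 0" if "w n = k" for n
      using zero[OF that] S(1) by blast
    show "{1..k - 1} \<subseteq> S" using S(1) assms(5) by blast
    show "w (n + s) \<noteq> 0" if "s \<in> S" "w n = 0" for n s
      using avoid that S(2) by blast
  qed (fact block le after)+
  have nim_periodic: "is_nim_sequence (omega_power (factor w 0 (a i))) {s \<in> S. s < a i}"
    if S: "T \<subseteq> S" "S \<subseteq> I"
      and border: "\<forall>b \<in> N. b < a i \<longrightarrow> {b + a i - s | s. s \<in> {s \<in> S. s < a i}} \<subseteq> L" for S i
  \<comment> \<open>Since \<open>a 0 = 1\<close> is below \<open>k\<close>, the moves
    \<open>1..k - 1\<close> do not survive truncation at \<open>i = 0\<close>; the game then has no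
    moves and the word is constantly 0.\<close>
  proof (cases "i = 0")
    case True
    then have a1: "a i = 1" using assms(1) by (simp add: representing_sequence_def)
    then have "{s \<in> S. s < a i} = {}" using S(2) assms(8) by auto
    then show ?thesis
      unfolding is_nim_sequence_def using a1 w0 by (simp only: SG_empty) (simp add: omega_power_factor_0)
  next
    case False
    have pos: "0 < a i" using assms(1) by (simp add: representing_sequence_def)
    have k_le: "k \<le> a i"
      using assms(1,2) False by (auto simp: representing_sequence_def strict_mono_less_eq)
    let ?u = "\<lambda>n. w (n mod a i)"
    have minus_mod: "(n - v) mod a i = n mod a i - v" if "v \<le> n mod a i" for n v
    proof -
      have "n - v = (n mod a i - v) + n div a i * a i"
        using that div_mult_mod_eq[of n "a i"] by linarith
      moreover have "n mod a i - v < a i"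
        using pos by (meson diff_le_self le_less_trans mod_less_divisor)
      ultimately show ?thesis by simp
    qed
    have "is_nim_sequence ?u {s \<in> S. s < a i}"
    proof (rule is_nim_sequenceI[where k = k])
      show "v \<le> n \<and> ?u (n - v) = ?u n - v" if "v \<le> ?u n" for n v
        using block[OF that] minus_mod by (metis le_trans mod_less_eq_dividend)
      show "?u n \<le> k" for n by (rule le)
      \<comment> \<open>At the end of a period the index wraps to 0, where \<open>w 0 = 0\<close>
        takes the place of \<open>after\<close>.\<close>
      show "?u (n + 1) = 0" if "?u n = k" for n
        using after[OF that] w0 by (simp add: mod_Suc)
      show "\<exists>s\<in>{s \<in> S. s < a i}. 0 < s \<and> s \<le> n \<and> ?u (n - s) = 0" if un: "?u n = k" for n
      proof -
        obtain s where s: "s \<in> T" "0 < s" "s \<le> n mod a i" "w (n mod a i - s) = 0"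
          using zero[OF un] by blast
        \<comment> \<open>The move found for the residue does not leave its period, so it survives
          truncation to \<open>s < a i\<close>.\<close>
        have "s < a i" using s(3) pos by (meson le_less_trans mod_less_divisor)
        moreover have "s \<le> n" using s(3) mod_less_eq_dividend le_trans by blast
        moreover have "?u (n - s) = 0" using minus_mod[OF s(3)] s(4) by simp
        ultimately show ?thesis using s S(1) by blast
      qed
      show "{1..k - 1} \<subseteq> {s \<in> S. s < a i}" using S(1) assms(5) k_le by auto
      show "?u (n + s) \<noteq> 0" if s: "s \<in> {s \<in> S. s < a i}" and un: "?u n = 0" for n s
      proof
        assume us: "?u (n + s) = 0"
        let ?r = "n mod a i"
        have r: "?r < a i" using pos by simp
        have mod: "(n + s) mod a i = (?r + s) mod a i" by (simp add: mod_add_left_eq)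
        show False
        proof (cases "?r + s < a i")
          case True
          then show False using avoid[of s ?r] s un us S(2) mod by auto
        next
          case False
          \<comment> \<open>The second zero lies in the next period, at residue \<open>?b\<close>.
            Going back \<open>s\<close> from \<open>?b + a i\<close> gives \<open>?r\<close>, which
            \<open>border\<close> puts into \<open>L\<close> although
            \<open>w ?r = 0\<close>.\<close>
          let ?b = "?r + s - a i"
          have b: "?b < a i" "?r + s = ?b + a i" using False r s by (simp_all, linarith)
          have "(?r + s) mod a i = ?b" using b by (metis mod_add_self2 mod_less)
          then have "?b \<in> N" using us mod N_iff by simp
          then have "?b + a i - s \<in> L" using border b(1) s by blast
          moreover have "?b + a i - s = ?r" using b(2) by simp
          ultimately have "?r \<in> L" by (simp only:)
          then show False using un N_iff assms(7) by simp
        qed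
      qed
    qed
    moreover have "omega_power (factor w 0 (a i)) = ?u"
      using omega_power_factor_0[OF pos] by blast
    ultimately show ?thesis by simp
  qed
  show ?thesis using nim nim_periodic by blast
qed

end
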